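(* Let $f:\mathbb N\to\mathbb N$ be a function with $f(n)\to\infty$ as $n\to\infty$. For every $n$ such that $f(n)\ge 3$ and $f(n)$ divides $n-2$, let $G_n$ be the generalized theta graph with $(n-2)/f(n)$ paths each having exactly $f(n)$ internal nodes. Then $G_n$ has $n$ vertices and $n(1+1/f(n))-2(1+1/f(n))$ edges (so edge density $1+1/f(n)-\frac{2}{n}(1+1/f(n))$), and Broadcast on $G_n$ requires exactly $(n-2)/f(n)$ ignorant agents, i.e. it is solvable with $k$ ignorant agents if and only if $k\ge (n-2)/f(n)$.
   Context: Generalized theta graph: two distinct fixed nodes (the poles) joined by internally vertex-disjoint paths, each path having a prescribed number of internal nodes. Edge density of a graph with $m$ edges and $n$ nodes is $m/n$. Broadcast model: a connected base graph $G=(V,E)$ with $n$ nodes. There is one source agent holding a message $\mathcal M$ and $k\ge1$ ignorant agents (agents not holding $\mathcal M$); initially all agents occupy pairwise distinct nodes, the initial placement being chosen by the adversary. Time proceeds in synchronous rounds; in each round: (1) the adversary removes a (possibly empty) set $E'\subseteq E$ of edges such that $(V,E\setminus E')$ is connected; (2) each agent (agents have unique IDs, local memory, and see the entire current graph, the positions of all agents and which agents hold $\mathcal M$) chooses either to stay or to traverse an edge of $E\setminus E'$ incident to its current node; (3) agents move. Whenever an ignorant agent is at the same node as an agent holding $\mathcal M$, it receives $\mathcal M$ and becomes a source agent. The adversary is adaptive and knows the agents' strategy. Broadcast is solvable on $G$ with $k$ ignorant agents if the agents have a strategy such that, for every initial placement and every adversary behaviour, after finitely many rounds all agents hold $\mathcal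 M$; otherwise the adversary is said to have a winning strategy. *)

theory Defs
  imports Complex_Main
begin

section \<open>Graphs\<close>

text \<open>An undirected simple graph is given by a vertex set V and a set E of
  2-element edges (each edge is the set of its two endpoints).\<close>

definition adj :: "'v set set \<Rightarrow> ('v \<times> 'v) set" where
  "adj E = {(x, y). {x, y} \<in> E}"

definition connected_graph :: "'v set \<Rightarrow> 'v set set \<Rightarrow> bool" where
  "connected_graph V E \<longleftrightarrow> (\<forall>u\<in>V. \<forall>w\<in>V. (u, w) \<in> (adj E)\<^sup>*)"

section \<open>Generalized theta graphs\<close>

datatype tvert = Pole bool | Inner nat nat

text \<open>Generalized theta graph with poles Pole False and Pole True, and one path
  per entry of ls; path i has internal nodes Inner i 1, ..., Inner i (ls!i).\<close>

definition theta_V :: "nat list \<Rightarrow> tvert set" where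
  "theta_V ls = {Pole False, Pole True} \<union>
     {Inner i j | i j. i < length ls \<and> 1 \<le> j \<and> j \<le> ls ! i}"

definition theta_E :: "nat list \<Rightarrow> tvert set set" where
  "theta_E ls =
     {{Inner i j, Inner i (Suc j)} | i j. i < length ls \<and> 1 \<le> j \<and> j < ls ! i}
   \<union> {{Pole False, Inner i 1} | i. i < length ls \<and> 1 \<le> ls ! i}
   \<union> {{Inner i (ls ! i), Pole True} | i. i < length ls \<and> 1 \<le> ls ! i}
   \<union> {{Pole False, Pole True} | i. i < length ls \<and> ls ! i = 0}"

section \<open>The Broadcast game\<close>

text \<open>Agents are 0..k; agent 0 is the initial source, agents 1..k are ignorant.
  A configuration consists of the positions of the agents and the set of agents
  holding the message.\<close>

type_synonym 'v cfg = "(nat \<Rightarrow> 'v) \<times> nat set"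

text \<open>A history is the list of observations made so far: for each round, the
  set of edges removed by the adversary in that round together with the
  configuration at the start of that round.\<close>

type_synonym 'v hist = "('v set set \<times> 'v cfg) list"

text \<open>Joint (deterministic, full-information, full-memory) agent strategy:
  maps the history (whose last entry contains the current removed edges and the
  current configuration) to the target node of every agent.\<close>
type_synonym 'v strategy = "'v hist \<Rightarrow> nat \<Rightarrow> 'v"

text \<open>Adaptive adversary: given the previous history and the current
  configuration, chooses the set of edges removed in the current round.\<close>
type_synonym 'v adversary = "'v hist \<Rightarrow> 'v cfg \<Rightarrow> 'v set set"

definition step :: "nat \<Rightarrow> 'v cfg \<Rightarrow> (nat \<Rightarrow> 'v) \<Rightarrow> 'v cfg" where
  "step k c mv = (mv, snd c \<union> {a. a \<le> k \<and> (\<exists>b\<in>snd c. mv b = mv a)})"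

fun run :: "nat \<Rightarrow> 'v strategy \<Rightarrow> 'v adversary \<Rightarrow> (nat \<Rightarrow> 'v) \<Rightarrow> nat \<Rightarrow> 'v hist" where
  "run k \<sigma> adv p0 0 = [(adv [] (p0, {0}), (p0, {0}))]"
| "run k \<sigma> adv p0 (Suc t) =
     (let H = run k \<sigma> adv p0 t;
          c' = step k (snd (last H)) (\<sigma> H)
      in H @ [(adv H c', c')])"

text \<open>Removed edges / configuration in round t.\<close>
definition removed_at :: "nat \<Rightarrow> 'v strategy \<Rightarrow> 'v adversary \<Rightarrow> (nat \<Rightarrow> 'v) \<Rightarrow> nat \<Rightarrow> 'v set set" where
  "removed_at k \<sigma> adv p0 t = fst (run k \<sigma> adv p0 t ! t)"

definition cfg_at :: "nat \<Rightarrow> 'v strategy \<Rightarrow> 'v adversary \<Rightarrow> (nat \<Rightarrow> 'v) \<Rightarrow> nat \<Rightarrow> 'v cfg" where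
  "cfg_at k \<sigma> adv p0 t = snd (run k \<sigma> adv p0 t ! t)"

text \<open>The adversary's choice is admissible: a subset of E whose removal keeps
  the graph connected.\<close>
definition adm_removal :: "'v set \<Rightarrow> 'v set set \<Rightarrow> 'v set set \<Rightarrow> bool" where
  "adm_removal V E R \<longleftrightarrow> R \<subseteq> E \<and> connected_graph V (E - R)"

text \<open>Each agent stays or traverses a present edge incident to its node.\<close>
definition legal_moves :: "'v set set \<Rightarrow> nat \<Rightarrow> 'v set set \<Rightarrow> 'v cfg \<Rightarrow> 'v cfg \<Rightarrow> bool" where
  "legal_moves E k R c c' \<longleftrightarrow>
     (\<forall>a\<le>k. fst c' a = fst c a \<or> {fst c a, fst c' a} \<in> E - R)"

definition broadcast_solvable :: "'v set \<Rightarrow> 'v set set \<Rightarrow> nat \<Rightarrow> bool" where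
  "broadcast_solvable V E k \<longleftrightarrow>
    (\<exists>\<sigma> :: 'v strategy.
      \<forall>p0. inj_on p0 {..k} \<and> p0 ` {..k} \<subseteq> V \<longrightarrow>
      (\<forall>adv :: 'v adversary.
         (\<forall>t. adm_removal V E (removed_at k \<sigma> adv p0 t)) \<longrightarrow>
         (\<forall>t. legal_moves E k (removed_at k \<sigma> adv p0 t)
                (cfg_at k \<sigma> adv p0 t) (cfg_at k \<sigma> adv p0 (Suc t)))
         \<and> (\<exists>t. {..k} \<subseteq> snd (cfg_at k \<sigma> adv p0 t))))"

end

theory Submission
  imports Defs
begin

text \<open>
  An admissible removal cuts each path at most once and leaves some path intact.

  With at most \<open>p\<close> agents in total, the adversary keeps one pole \<open>A\<close>, together with the stretch of
  the source's path between \<open>A\<close> and the source, free of ignorant agents. If an ignorant agent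
  threatens \<open>A\<close> on every other path, those are all the ignorant agents and cutting their edges to
  \<open>A\<close> suffices; otherwise the edge beyond the source can be cut as well. A source standing on a
  pole is fenced off from all paths with ignorant agents inside, and there are fewer than \<open>p\<close> of
  these.

  With \<open>p + 1\<close> agents, informed and ignorant ones can be forced to meet. Two agents inside one
  path move apart until one of them reaches a pole, as a single cut cannot stop both; so
  eventually every path has at most one agent inside and some agent \<open>e\<close> is on a pole \<open>A\<close>. Assign
  the other \<open>p\<close> agents to the \<open>p\<close> paths. Those of the kind opposite to \<open>e\<close> head for \<open>A\<close>, the others
  for the opposite pole; the intact path gives progress in every round. Either \<open>e\<close> is met, or
  agents of its kind hold both poles and squeeze an opposite agent between them.
\<close>

section \<open>Runs, winning strategies and invariants\<close>

lemma length_run [simp]: "length (run k \<sigma> adv p0 t) = Suc t"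
  by (induction t) (auto simp: Let_def)

lemma last_run: "last (run k \<sigma> adv p0 t) = (removed_at k \<sigma> adv p0 t, cfg_at k \<sigma> adv p0 t)"
proof -
  have "run k \<sigma> adv p0 t \<noteq> []"
    by (metis length_run list.size(3) nat.distinct(1))
  then show ?thesis
    by (simp add: last_conv_nth removed_at_def cfg_at_def)
qed

lemma cfg_at_0 [simp]: "cfg_at k \<sigma> adv p0 0 = (p0, {0})"
  by (simp add: cfg_at_def)

lemma cfg_at_Suc:
  "cfg_at k \<sigma> adv p0 (Suc t) = step k (cfg_at k \<sigma> adv p0 t) (\<sigma> (run k \<sigma> adv p0 t))"
  using last_run[of k \<sigma> adv p0 t] by (simp add: cfg_at_def Let_def nth_append)

text \<open>The history \<open>H\<close> stays unspecified because the adversary built below reacts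
  to the current positions alone.\<close>

lemma removed_at_adversary: "\<exists>H. removed_at k \<sigma> adv p0 t = adv H (cfg_at k \<sigma> adv p0 t)"
  by (cases t) (auto simp: removed_at_def cfg_at_def Let_def nth_append)

section \<open>Bounded horizons and positional strategies\<close>

lemma fst_step [simp]: "fst (step k c mv) = mv"
  by (simp add: step_def)

text \<open>Backward induction over single configurations, so that a move depends only on the
  configuration and the current removal. The first disjunct makes the predicate monotone in
  \<open>m\<close>.\<close>

primrec wins_within :: "'v set \<Rightarrow> 'v set set \<Rightarrow> nat \<Rightarrow> nat \<Rightarrow> 'v cfg \<Rightarrow> bool" where
  "wins_within V E k 0 c \<longleftrightarrow> {..k} \<subseteq> snd c"
| "wins_within V E k (Suc m) c \<longleftrightarrow> wins_within V E k m c \<or>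
     (\<forall>R. adm_removal V E R \<longrightarrow>
       (\<exists>mv. legal_moves E k R c (step k c mv) \<and> wins_within V E k m (step k c mv)))"

definition wins :: "'v set \<Rightarrow> 'v set set \<Rightarrow> nat \<Rightarrow> 'v cfg \<Rightarrow> bool" where
  "wins V E k c \<longleftrightarrow> (\<exists>m. wins_within V E k m c)"

lemma wins_within_mono: "wins_within V E k m c \<Longrightarrow> m \<le> m' \<Longrightarrow> wins_within V E k m' c"
  by (induction m' rule: nat_induct) (auto simp: le_Suc_eq)

text \<open>The horizon may depend on \<open>R\<close>. As \<open>E\<close> is finite there are
  finitely many admissible removals, and the largest horizon serves for all.\<close>

lemma winsI:
  assumes "finite E"
    and "\<And>R. adm_removal V E R \<Longrightarrow>
           \<exists>mv. legal_moves E k R c (step k c mv) \<and> wins V E k (step k c mv)"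
  shows "wins V E k c"
proof -
  let ?A = "{R. adm_removal V E R}"
  have "?A \<subseteq> Pow E"
    by (auto simp: adm_removal_def)
  then have fin: "finite ?A"
    using assms(1) finite_subset by blast
  have "\<forall>R\<in>?A. \<exists>m mv. legal_moves E k R c (step k c mv) \<and> wins_within V E k m (step k c mv)"
    using assms(2) unfolding wins_def by blast
  then obtain m where m: "\<forall>R\<in>?A. \<exists>mv. legal_moves E k R c (step k c mv) \<and>
      wins_within V E k (m R) (step k c mv)"
    by metis
  define N where "N = Max (insert 0 (m ` ?A))"
  have "m R \<le> N" if "R \<in> ?A" for R
    using fin that by (auto simp: N_def intro!: Max_ge)
  with m have "wins_within V E k (Suc N) c"
    by (simp, meson wins_within_mono)
  then show ?thesis
    unfolding wins_def by blast
qed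

text \<open>A positional strategy is not told which horizon applies, so one move has to serve every
  \<open>m\<close>. A move that is good for the least horizon does, by monotonicity; if no horizon
  wins, staying put is legal.\<close>

lemma ex_good_move:
  assumes "adm_removal V E R"
  shows "\<exists>mv. legal_moves E k R c (step k c mv) \<and>
           (\<forall>m. wins_within V E k m c \<longrightarrow> wins_within V E k (m - 1) (step k c mv))"
proof (cases "wins V E k c")
  case False
  then show ?thesis
    by (intro exI[of _ "fst c"]) (auto simp: wins_def legal_moves_def)
next
  case True
  define r where "r = (LEAST m. wins_within V E k m c)"
  have r: "wins_within V E k r c"
    using True unfolding r_def wins_def by (metis LeastI_ex)
  have min: "r \<le> m" if "wins_within V E k m c" for m
    using that unfolding r_def by (rule Least_le)
  have "\<exists>mv. legal_moves E k R c (step k c mv) \<and> wins_within V E k (r - 1) (step k c mv)"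
  proof (cases r)
    \<comment> \<open>Everybody is informed already, and staying put keeps this;
      \<open>r - 1\<close> is again \<open>0\<close>.\<close>
    case 0
    with r show ?thesis
      by (intro exI[of _ "fst c"]) (auto simp: legal_moves_def step_def)
  next
    case (Suc m)
    then have "\<not> wins_within V E k m c"
      using min by fastforce
    with r Suc assms show ?thesis
      by auto
  qed
  then show ?thesis
    using min by (meson diff_le_mono wins_within_mono)
qed

text \<open>Choosing a good move in every round lowers the remaining horizon until it is
  \<open>0\<close>; the moves stay legal afterwards.\<close>

lemma broadcast_solvableI:
  fixes V :: "'v set"
  assumes "\<And>p0. inj_on p0 {..k} \<Longrightarrow> p0 ` {..k} \<subseteq> V \<Longrightarrow> wins V E k (p0, {0})"
  shows "broadcast_solvable V E k"
proof -
  define good where "good R c mv \<longleftrightarrow> legal_moves E k R c (step k c mv) \<and>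
      (\<forall>m. wins_within V E k m c \<longrightarrow> wins_within V E k (m - 1) (step k c mv))"
    for R and c :: "'v cfg" and mv
  define \<sigma> :: "'v strategy" where
    "\<sigma> H = (SOME mv. good (fst (last H)) (snd (last H)) mv)" for H
  have ex: "\<exists>mv. good R c mv" if "adm_removal V E R" for R c
    using ex_good_move[OF that] unfolding good_def by blast
  have good_\<sigma>: "good (fst (last H)) (snd (last H)) (\<sigma> H)" if "adm_removal V E (fst (last H))" for H
    using someI_ex[OF ex[OF that]] unfolding \<sigma>_def .
  show ?thesis
    unfolding broadcast_solvable_def
  proof (intro exI[of _ \<sigma>] allI impI)
    fix p0 :: "nat \<Rightarrow> 'v" and adv :: "'v adversary"
    assume "inj_on p0 {..k} \<and> p0 ` {..k} \<subseteq> V"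
    then obtain N where N: "wins_within V E k N (p0, {0})"
      using assms unfolding wins_def by blast
    assume adm: "\<forall>t. adm_removal V E (removed_at k \<sigma> adv p0 t)"
    have good: "good (removed_at k \<sigma> adv p0 t) (cfg_at k \<sigma> adv p0 t) (\<sigma> (run k \<sigma> adv p0 t))" for t
      using good_\<sigma>[of "run k \<sigma> adv p0 t"] adm by (simp add: last_run)
    have "wins_within V E k (N - t) (cfg_at k \<sigma> adv p0 t)" for t
    proof (induction t)
      case 0
      then show ?case using N by simp
    next
      case (Suc t)
      then show ?case
        using good[of t] by (auto simp: good_def cfg_at_Suc)
    qed
    from this[of N] have "{..k} \<subseteq> snd (cfg_at k \<sigma> adv p0 N)"
      by simp
    moreover have "legal_moves E k (removed_at k \<sigma> adv p0 t)
                (cfg_at k \<sigma> adv p0 t) (cfg_at k \<sigma> adv p0 (Suc t))" for t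
      using good[of t] by (simp add: good_def cfg_at_Suc)
    ultimately show "(\<forall>t. legal_moves E k (removed_at k \<sigma> adv p0 t)
                (cfg_at k \<sigma> adv p0 t) (cfg_at k \<sigma> adv p0 (Suc t)))
         \<and> (\<exists>t. {..k} \<subseteq> snd (cfg_at k \<sigma> adv p0 t))"
      by blast
  qed
qed

section \<open>Adversaries from invariants\<close>

text \<open>While the invariant holds, no ignorant agent shares the node of agent \<open>0\<close>,
  so the informed set stays \<open>{0}\<close> for ever.\<close>

lemma not_broadcast_solvable_if_invariant:
  fixes V :: "'v set" and Inv :: "(nat \<Rightarrow> 'v) \<Rightarrow> bool"
  assumes "1 \<le> k" "adm_removal V E {}"
    and p0: "inj_on p0 {..k}" "p0 ` {..k} \<subseteq> V" "Inv p0"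
    and sep: "\<And>pos a. Inv pos \<Longrightarrow> 1 \<le> a \<Longrightarrow> a \<le> k \<Longrightarrow> pos a \<noteq> pos 0"
    and step: "\<And>pos. Inv pos \<Longrightarrow> \<exists>R. adm_removal V E R \<and>
        (\<forall>mv. (\<forall>a\<le>k. mv a = pos a \<or> {pos a, mv a} \<in> E - R) \<longrightarrow> Inv mv)"
  shows "\<not> broadcast_solvable V E k"
proof
  assume "broadcast_solvable V E k"
  then obtain \<sigma> :: "'v strategy" where \<sigma>: "\<And>adv.
       (\<forall>t. adm_removal V E (removed_at k \<sigma> adv p0 t)) \<Longrightarrow>
         (\<forall>t. legal_moves E k (removed_at k \<sigma> adv p0 t)
                (cfg_at k \<sigma> adv p0 t) (cfg_at k \<sigma> adv p0 (Suc t)))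
         \<and> (\<exists>t. {..k} \<subseteq> snd (cfg_at k \<sigma> adv p0 t))"
    unfolding broadcast_solvable_def using p0 by blast
  define good where "good pos R \<longleftrightarrow> adm_removal V E R \<and>
        (\<forall>mv. (\<forall>a\<le>k. mv a = pos a \<or> {pos a, mv a} \<in> E - R) \<longrightarrow> Inv mv)" for pos R
  define adv :: "'v adversary" where
    \<comment> \<open>Removing nothing outside the invariant makes the adversary admissible on all
      arguments.\<close>
    "adv H c = (if Inv (fst c) then SOME R. good (fst c) R else {})" for H c
  have good: "good (fst c) (adv H c)" if "Inv (fst c)" for H c
  proof -
    have "\<exists>R. good (fst c) R"
      using step[OF that] unfolding good_def .
    from someI_ex[OF this] show ?thesis
      using that by (simp add: adv_def)
  qed
  have adm: "adm_removal V E (adv H c)" for H c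
    using good[of c H] assms(2) by (cases "Inv (fst c)") (auto simp: good_def adv_def)
  let ?c = "cfg_at k \<sigma> adv p0"
  have "\<forall>t. adm_removal V E (removed_at k \<sigma> adv p0 t)"
    using adm removed_at_adversary by metis
  note run = \<sigma>[OF this]
  have inv: "Inv (fst (?c t)) \<and> snd (?c t) = {0}" for t
  proof (induction t)
    case 0
    then show ?case using p0 by simp
  next
    case (Suc t)
    have "good (fst (?c t)) (removed_at k \<sigma> adv p0 t)"
      using removed_at_adversary[of k \<sigma> adv p0 t] good Suc by metis
    then have *: "Inv (fst (?c (Suc t)))"
      using run unfolding good_def legal_moves_def by blast
    have "a = 0" if "a \<le> k" "fst (?c (Suc t)) 0 = fst (?c (Suc t)) a" for a
      using sep[OF *, of a] that by (metis less_one not_less)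
    moreover have "snd (?c (Suc t)) =
        insert 0 {a. a \<le> k \<and> fst (?c (Suc t)) 0 = fst (?c (Suc t)) a}"
      using conjunct2[OF Suc] by (simp add: cfg_at_Suc step_def)
    ultimately have "snd (?c (Suc t)) = {0}"
      by blast
    with * show ?case by blast
  qed
  obtain t where "{..k} \<subseteq> snd (?c t)"
    using run by blast
  then have "1 \<in> snd (?c t)"
    using assms(1) by auto
  with inv[of t] show False
    by simp
qed

section \<open>Theta graphs in path coordinates\<close>

text \<open>\<open>nd i j\<close> is the \<open>j\<close>-th node of path \<open>i\<close>, where positions \<open>0\<close> and \<open>L + 1\<close> are the two poles
  for every \<open>i\<close>. The axioms are invariant under exchanging the poles, which halves all case
  distinctions.\<close>

locale theta_paths =
  fixes V :: "'v set" and E :: "'v set set" and p L :: nat and nd :: "nat \<Rightarrow> nat \<Rightarrow> 'v"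
  assumes p_pos: "1 \<le> p" and L_ge_2: "2 \<le> L"
    and V_eq: "V = {nd i j | i j. i < p \<and> j \<le> Suc L}"
    and E_eq: "E = {{nd i j, nd i (Suc j)} | i j. i < p \<and> j \<le> L}"
    and nd_eq_iff: "\<And>i i' j j'. i < p \<Longrightarrow> i' < p \<Longrightarrow> j \<le> Suc L \<Longrightarrow> j' \<le> Suc L \<Longrightarrow>
      nd i j = nd i' j' \<longleftrightarrow> j = j' \<and> (i = i' \<or> j = 0 \<or> j = Suc L)"
begin

section \<open>Nodes, neighbours and edges\<close>

lemma reversed: "theta_paths V E p L (\<lambda>i j. nd i (Suc L - j))"
proof
  show "V = {nd i (Suc L - j) | i j. i < p \<and> j \<le> Suc L}"
    unfolding V_eq by (auto, metis diff_diff_cancel diff_le_self, metis diff_le_self)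
  have "\<exists>j'\<le>L. {nd i j, nd i (Suc j)} = {nd i (Suc L - j'), nd i (Suc L - Suc j')}" if "j \<le> L" for i j
    using that by (intro exI[of _ "L - j"]) (auto simp: Suc_diff_le)
  moreover have "\<exists>j'\<le>L. {nd i (Suc L - j), nd i (Suc L - Suc j)} = {nd i j', nd i (Suc j')}" if "j \<le> L" for i j
    using that by (intro exI[of _ "L - j"]) (auto simp: Suc_diff_le)
  ultimately show "E = {{nd i (Suc L - j), nd i (Suc L - Suc j)} | i j. i < p \<and> j \<le> L}"
    unfolding E_eq by blast
next
  fix i i' j j'
  assume "i < p" "i' < p" "j \<le> Suc L" "j' \<le> Suc L"
  then show "nd i (Suc L - j) = nd i' (Suc L - j') \<longleftrightarrow> j = j' \<and> (i = i' \<or> j = 0 \<or> j = Suc L)"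
    using nd_eq_iff[of i i' "Suc L - j" "Suc L - j'"] by auto
qed (use p_pos L_ge_2 in auto)

lemma left_pole_eq: "i < p \<Longrightarrow> i' < p \<Longrightarrow> nd i 0 = nd i' 0"
  by (simp add: nd_eq_iff)

lemma right_pole_eq: "i < p \<Longrightarrow> i' < p \<Longrightarrow> nd i (Suc L) = nd i' (Suc L)"
  by (simp add: nd_eq_iff)

lemma nd_in_V: "i < p \<Longrightarrow> j \<le> Suc L \<Longrightarrow> nd i j \<in> V"
  by (auto simp: V_eq)

lemma V_cases:
  assumes "v \<in> V"
  obtains i j where "i < p" "j \<le> Suc L" "v = nd i j"
  using assms by (auto simp: V_eq)

lemma edge_in_E: "i < p \<Longrightarrow> j \<le> L \<Longrightarrow> {nd i j, nd i (Suc j)} \<in> E"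
  by (auto simp: E_eq)

lemma edge_cases:
  assumes "{x, y} \<in> E"
  obtains i j where "i < p" "j \<le> L" "x = nd i j" "y = nd i (Suc j)"
  | i j where "i < p" "j \<le> L" "y = nd i j" "x = nd i (Suc j)"
  using assms unfolding E_eq by (auto simp: doubleton_eq_iff)

lemma inner_neighbour:
  assumes "{nd i j, y} \<in> E" "i < p" "1 \<le> j" "j \<le> L"
  shows "y = nd i (j - 1) \<or> y = nd i (Suc j)"
  using assms(1)
proof (cases rule: edge_cases)
  case (1 i' j')
  then show ?thesis using assms nd_eq_iff[of i i' j j'] by auto
next
  case (2 i' j')
  then show ?thesis using assms nd_eq_iff[of i i' j "Suc j'"] by auto
qed

text \<open>The last equation renames the edge as the first edge of the path it enters, the form in
  which cuts are given.\<close>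

lemma left_pole_neighbour:
  assumes "{nd i 0, y} \<in> E" "i < p"
  shows "\<exists>i'<p. y = nd i' 1 \<and> {nd i 0, y} = {nd i' 0, nd i' 1}"
  using assms(1)
proof (cases rule: edge_cases)
  case (1 i' j')
  then show ?thesis using assms nd_eq_iff[of i i' 0 j'] by auto
next
  case (2 i' j')
  then show ?thesis using assms nd_eq_iff[of i i' 0 "Suc j'"] by auto
qed

text \<open>As \<open>2 \<le> L\<close>, no edge joins the two poles; every edge has an inner
  endpoint, which determines the path.\<close>

lemma inj_on_edge: "inj_on (\<lambda>(i, j). {nd i j, nd i (Suc j)}) ({..<p} \<times> {..L})"
proof (rule inj_onI, clarsimp)
  fix i j i' j'
  assume *: "i < p" "i' < p" "j \<le> L" "j' \<le> L"
    and eq: "{nd i j, nd i (Suc j)} = {nd i' j', nd i' (Suc j')}"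
  then have "j = j' \<and> (nd i j = nd i' j' \<and> nd i (Suc j) = nd i' (Suc j'))"
    by (auto simp: doubleton_eq_iff nd_eq_iff)
  then show "i = i' \<and> j = j'"
    using * L_ge_2 by (auto simp: nd_eq_iff)
qed

lemma edge_eq_iff:
  "i < p \<Longrightarrow> i' < p \<Longrightarrow> j \<le> L \<Longrightarrow> j' \<le> L \<Longrightarrow>
    {nd i j, nd i (Suc j)} = {nd i' j', nd i' (Suc j')} \<longleftrightarrow> i = i' \<and> j = j'"
  using inj_on_edge unfolding inj_on_def by fastforce

lemma E_eq_image: "E = (\<lambda>(i, j). {nd i j, nd i (Suc j)}) ` ({..<p} \<times> {..L})"
  unfolding E_eq by auto

lemma finite_E: "finite E"
  by (simp add: E_eq_image)

lemma card_E: "card E = p * Suc L"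
  unfolding E_eq_image by (simp add: card_image[OF inj_on_edge] card_cartesian_product)

section \<open>Admissible removals\<close>

text \<open>Used to refute connectivity: a nonempty set closed under the remaining edges would have
  to contain a pole that it misses.\<close>

lemma mem_closed_set_if_connected:
  assumes "connected_graph V (E - R)" "x \<in> S" "x \<in> V" "y \<in> V"
    and "\<And>x y. x \<in> S \<Longrightarrow> {x, y} \<in> E - R \<Longrightarrow> y \<in> S"
  shows "y \<in> S"
proof -
  have "(x, y) \<in> (adj (E - R))\<^sup>*"
    using assms unfolding connected_graph_def by blast
  then show ?thesis
    by (induction rule: rtrancl_induct) (use assms in \<open>auto simp: adj_def\<close>)
qed

text \<open>Two cuts in one path would separate the inner nodes between them from the poles.\<close>

lemma at_most_one_cut:
  assumes "adm_removal V E R" "i < p" "j1 < j2" "j2 \<le> L"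
    and cut: "{nd i j1, nd i (Suc j1)} \<in> R" "{nd i j2, nd i (Suc j2)} \<in> R"
  shows False
proof -
  define S where "S = {nd i j | j. j1 < j \<and> j \<le> j2}"
  have "nd i 0 \<in> S"
  proof (rule mem_closed_set_if_connected[of R "nd i (Suc j1)"])
    fix x y assume "x \<in> S" and xy: "{x, y} \<in> E - R"
    then obtain j where j: "x = nd i j" "j1 < j" "j \<le> j2"
      unfolding S_def by blast
    with xy have "y = nd i (j - 1) \<or> y = nd i (Suc j)"
      using inner_neighbour[of i j y] assms by auto
    then show "y \<in> S"
    proof
      assume y: "y = nd i (j - 1)"
      have "j - 1 \<noteq> j1"
      proof
        assume "j - 1 = j1"
        then have "j = Suc j1" using j by simp
        with xy y j cut show False by (simp add: insert_commute)
      qed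
      then show ?thesis
        unfolding S_def y using j by (intro CollectI exI[of _ "j - 1"]) auto
    next
      assume y: "y = nd i (Suc j)"
      have "j \<noteq> j2"
        using xy y j cut by auto
      then show ?thesis
        unfolding S_def y using j by (intro CollectI exI[of _ "Suc j"]) auto
    qed
  qed (use assms nd_in_V in \<open>auto simp: adm_removal_def S_def\<close>)
  then obtain j where "nd i 0 = nd i j" "j1 < j" "j \<le> j2"
    unfolding S_def by blast
  then show False
    using nd_eq_iff[of i i 0 j] assms by auto
qed

text \<open>If every path had a cut, the nodes before the cuts would form a closed set without the
  right pole.\<close>

lemma ex_intact_path:
  assumes "adm_removal V E R"
  shows "\<exists>i<p. \<forall>j\<le>L. {nd i j, nd i (Suc j)} \<notin> R"
proof (rule ccontr)
  assume "\<not> ?thesis"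
  then obtain c where c: "\<And>i. i < p \<Longrightarrow> c i \<le> L \<and> {nd i (c i), nd i (Suc (c i))} \<in> R"
    by metis
  define S where "S = {nd i j | i j. i < p \<and> j \<le> c i}"
  have "nd 0 0 \<in> S"
    unfolding S_def using p_pos by (intro CollectI exI[of _ 0]) auto
  have "nd 0 (Suc L) \<in> S"
  proof (rule mem_closed_set_if_connected[of R "nd 0 0"])
    fix x y assume "x \<in> S" and xy: "{x, y} \<in> E - R"
    then obtain i j where ij: "x = nd i j" "i < p" "j \<le> c i"
      unfolding S_def by blast
    show "y \<in> S"
    proof (cases "j = 0")
      case True
      \<comment> \<open>From the left pole the walk may enter any path \<open>i'\<close>. Its first
        edge is present, so the chosen cut of that path lies further on.\<close>
      then obtain i' where i': "i' < p" "y = nd i' 1" "{x, y} = {nd i' 0, nd i' 1}"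
        using left_pole_neighbour[of i y] xy ij by auto
      then have "c i' \<noteq> 0"
        using c[OF i'(1)] xy unfolding i'(3) by (auto intro!: gr0I)
      then show ?thesis
        unfolding S_def i' using i' by (intro CollectI exI[of _ i'] exI[of _ 1]) auto
    next
      case False
      then have "y = nd i (j - 1) \<or> y = nd i (Suc j)"
        using inner_neighbour[of i j y] ij xy c[OF ij(2)] by auto
      then show ?thesis
      proof
        assume "y = nd i (j - 1)"
        then show ?thesis
          unfolding S_def using ij by (intro CollectI exI[of _ i] exI[of _ "j - 1"]) auto
      next
        assume y: "y = nd i (Suc j)"
        have "j \<noteq> c i"
          using xy y ij c[OF ij(2)] by auto
        then show ?thesis
          unfolding S_def y using ij by (intro CollectI exI[of _ i] exI[of _ "Suc j"]) auto
      qed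
    qed
  qed (use assms p_pos nd_in_V \<open>nd 0 0 \<in> S\<close> in \<open>auto simp: adm_removal_def\<close>)
  then obtain i j where ij: "nd 0 (Suc L) = nd i j" "i < p" "j \<le> c i"
    unfolding S_def by blast
  then show False
    using c[OF ij(2)] nd_eq_iff[of 0 i "Suc L" j] p_pos by auto
qed

definition cut_edges :: "nat set \<Rightarrow> (nat \<Rightarrow> nat) \<Rightarrow> 'v set set" where
  "cut_edges I c = (\<lambda>i. {nd i (c i), nd i (Suc (c i))}) ` I"

text \<open>A converse to the two facts above. The spared path joins the poles, and every node still
  reaches the pole on its own side of the cut.\<close>

lemma adm_cut_edges:
  assumes I: "I \<subset> {..<p}" and c: "\<And>i. i \<in> I \<Longrightarrow> c i \<le> L"
  shows "adm_removal V E (cut_edges I c)"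
proof -
  define A where "A = adj (E - cut_edges I c)"
  have sym: "sym A"
    by (auto simp: A_def sym_def adj_def insert_commute)
  have edge: "(nd i j, nd i (Suc j)) \<in> A" if "i < p" "j \<le> L" "i \<in> I \<Longrightarrow> j \<noteq> c i" for i j
  proof -
    have "{nd i j, nd i (Suc j)} \<notin> cut_edges I c"
    proof
      assume "{nd i j, nd i (Suc j)} \<in> cut_edges I c"
      then obtain i' where "i' \<in> I" "{nd i j, nd i (Suc j)} = {nd i' (c i'), nd i' (Suc (c i'))}"
        unfolding cut_edges_def by blast
      then show False
        using that I c[of i'] edge_eq_iff[of i i' j "c i'"] by auto
    qed
    then show ?thesis
      using that edge_in_E by (simp add: A_def adj_def)
  qed
  \<comment> \<open>The last premise keeps the cut of path \<open>i\<close> from lying between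
    \<open>j\<close> and \<open>j'\<close>.\<close>
  have segment: "(nd i j, nd i j') \<in> A\<^sup>*"
    if "i < p" "j \<le> j'" "j' \<le> Suc L" "i \<in> I \<Longrightarrow> j' \<le> c i \<or> c i < j" for i j j'
    using that(2,3,4)
  proof (induction j' rule: dec_induct)
    case (step m)
    then have "(nd i m, nd i (Suc m)) \<in> A"
      using that(1) by (intro edge) auto
    with step show ?case
      by (meson Suc_le_lessD le_eq_less_or_eq less_SucI not_less_eq_eq rtrancl.rtrancl_into_rtrancl)
  qed simp
  obtain i0 where i0: "i0 < p" "i0 \<notin> I"
    using I by blast
  have poles: "(nd i0 0, nd i0 (Suc L)) \<in> A\<^sup>*"
    using segment[of i0 0 "Suc L"] i0 by simp
  have flip: "(y, x) \<in> A\<^sup>*" if "(x, y) \<in> A\<^sup>*" for x y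
    using that sym by (meson symD sym_rtrancl)
  have to_pole: "(nd i0 0, v) \<in> A\<^sup>*" if "v \<in> V" for v
  proof -
    obtain i j where v: "v = nd i j" "i < p" "j \<le> Suc L"
      using \<open>v \<in> V\<close> by (elim V_cases)
    show ?thesis
    proof (cases "i \<in> I \<and> c i < j")
      case True
      then have "(v, nd i (Suc L)) \<in> A\<^sup>*"
        using segment[of i j "Suc L"] v by simp
      then have "(nd i0 (Suc L), v) \<in> A\<^sup>*"
        using flip right_pole_eq[OF v(2) i0(1)] by simp
      with poles show ?thesis by (meson rtrancl_trans)
    next
      case False
      then have "(nd i 0, v) \<in> A\<^sup>*"
        using segment[of i 0 j] v by auto
      then show ?thesis
        using left_pole_eq[OF v(2) i0(1)] by simp
    qed
  qed
  have "connected_graph V (E - cut_edges I c)"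
    unfolding connected_graph_def A_def[symmetric]
    using to_pole flip by (meson rtrancl_trans)
  moreover have "cut_edges I c \<subseteq> E"
    using I c edge_in_E by (auto simp: cut_edges_def)
  ultimately show ?thesis
    by (simp add: adm_removal_def)
qed

end

section \<open>Too few agents: shielding the source\<close>

text \<open>The coordinates \<open>nd\<close> are a parameter so that the notion can be read from
  either pole. The bound \<open>j \<le> L\<close> leaves out a source on the far pole, which is
  position \<open>0\<close> in reversed coordinates.\<close>

definition shielded :: "nat \<Rightarrow> nat \<Rightarrow> (nat \<Rightarrow> nat \<Rightarrow> 'v) \<Rightarrow> nat \<Rightarrow> (nat \<Rightarrow> 'v) \<Rightarrow> bool" where
  "shielded p L nd k pos \<longleftrightarrow> (\<exists>q j. q < p \<and> j \<le> L \<and> pos 0 = nd q j \<and>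
     (\<forall>a. 1 \<le> a \<and> a \<le> k \<longrightarrow> (\<forall>i\<le>j. pos a \<noteq> nd q i)))"

lemma shieldedI:
  "q < p \<Longrightarrow> j \<le> L \<Longrightarrow> pos 0 = nd q j \<Longrightarrow>
    (\<And>a i. 1 \<le> a \<Longrightarrow> a \<le> k \<Longrightarrow> i \<le> j \<Longrightarrow> pos a \<noteq> nd q i) \<Longrightarrow> shielded p L nd k pos"
  unfolding shielded_def by blast

context theta_paths
begin

text \<open>An inner node lies on one path only, so picking an occupant for each path is
  injective.\<close>

lemma card_occupied_paths_le:
  assumes "\<And>i. i \<in> I \<Longrightarrow> i < p \<and> (\<exists>a j. 1 \<le> a \<and> a \<le> k \<and> 1 \<le> j \<and> j \<le> L \<and> pos a = nd i j)"
  shows "card I \<le> k"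
proof -
  from assms obtain g h where
    gh: "\<And>i. i \<in> I \<Longrightarrow> 1 \<le> g i \<and> g i \<le> k \<and> 1 \<le> h i \<and> h i \<le> L \<and> pos (g i) = nd i (h i)"
    by metis
  have "inj_on g I"
  proof (rule inj_onI)
    fix i i' assume i: "i \<in> I" "i' \<in> I" "g i = g i'"
    then show "i = i'"
      using gh[of i] gh[of i'] assms[of i] assms[of i'] nd_eq_iff[of i i' "h i" "h i'"] by auto
  qed
  moreover have "g ` I \<subseteq> {1..k}"
    using gh by auto
  ultimately show ?thesis
    using card_inj_on_le[of g I "{1..k}"] by simp
qed

text \<open>Cutting the first edge of each path with an ignorant agent inside bars these agents from
  the pole and the source from these paths. At most \<open>k < p\<close> paths are cut; if the
  source leaves the pole, it enters an empty path.\<close>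

lemma shielded_at_pole_step:
  assumes "k < p" "pos 0 = nd 0 0" and free: "\<And>a. 1 \<le> a \<Longrightarrow> a \<le> k \<Longrightarrow> pos a \<noteq> nd 0 0"
  shows "\<exists>R. adm_removal V E R \<and>
    (\<forall>mv. (\<forall>a\<le>k. mv a = pos a \<or> {pos a, mv a} \<in> E - R) \<longrightarrow> shielded p L nd k mv)"
proof -
  define I where "I = {i. i < p \<and> (\<exists>a j. 1 \<le> a \<and> a \<le> k \<and> 1 \<le> j \<and> j \<le> L \<and> pos a = nd i j)}"
  define R where "R = cut_edges I (\<lambda>_. 0)"
  have "card I \<le> k"
    by (rule card_occupied_paths_le) (auto simp: I_def)
  then have "I \<noteq> {..<p}"
    using assms(1) by auto
  then have "I \<subset> {..<p}"
    by (auto simp: I_def)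
  then have adm: "adm_removal V E R"
    unfolding R_def by (rule adm_cut_edges) simp
  have cut: "{nd i 0, nd i 1} \<in> R" if "i \<in> I" for i
    using that by (auto simp: R_def cut_edges_def)
  have "shielded p L nd k mv" if mv: "\<And>a. a \<le> k \<Longrightarrow> mv a = pos a \<or> {pos a, mv a} \<in> E - R" for mv
  proof -
    have pole: "mv a \<noteq> nd 0 0" if a: "1 \<le> a" "a \<le> k" for a
    proof
      assume eq: "mv a = nd 0 0"
      then have edge: "{nd 0 0, pos a} \<in> E - R"
        using mv[OF a(2)] free[OF a] by (auto simp: insert_commute)
      then obtain i where i: "i < p" "pos a = nd i 1" "{nd 0 0, pos a} = {nd i 0, nd i 1}"
        using left_pole_neighbour[of 0 "pos a"] p_pos by auto
      then have "i \<in> I"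
        using a L_ge_2 unfolding I_def by (intro CollectI conjI exI[of _ a] exI[of _ 1]) auto
      with cut edge i show False by auto
    qed
    consider "mv 0 = nd 0 0" | "{nd 0 0, mv 0} \<in> E - R"
      using mv[of 0] assms(2) by auto
    then show ?thesis
    proof cases
      case 1
      then show ?thesis
        using p_pos pole by (intro shieldedI[of 0 _ 0]) auto
    next
      case 2
      then obtain q where q: "q < p" "mv 0 = nd q 1" "{nd 0 0, mv 0} = {nd q 0, nd q 1}"
        using left_pole_neighbour[of 0 "mv 0"] p_pos by auto
      then have "q \<notin> I"
        using 2 cut by auto
      then have empty: "pos a \<noteq> nd q j" if "1 \<le> a" "a \<le> k" "1 \<le> j" "j \<le> L" for a j
        using that q unfolding I_def by blast
      have "mv a \<noteq> nd q 1" if a: "1 \<le> a" "a \<le> k" for a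
      proof
        assume eq: "mv a = nd q 1"
        then have "{nd q 1, pos a} \<in> E - R"
          using mv[OF a(2)] empty[OF a, of 1] L_ge_2 by (auto simp: insert_commute)
        \<comment> \<open>Position \<open>2\<close> is still inside because
          \<open>2 \<le> L\<close>, so nobody can arrive at position \<open>1\<close> from the far
          side.\<close>
        then have "pos a = nd q 0 \<or> pos a = nd q 2"
          using inner_neighbour[of q 1 "pos a"] q L_ge_2 by (auto simp: numeral_2_eq_2)
        then show False
          using empty[OF a, of 2] L_ge_2 free[OF a] left_pole_eq[of q 0] q p_pos by auto
      qed
      moreover have "mv a \<noteq> nd q 0" if "1 \<le> a" "a \<le> k" for a
        using pole[OF that] left_pole_eq[of q 0] q p_pos by auto
      ultimately show ?thesis
        using q L_ge_2 by (intro shieldedI[of q _ 1]) (auto simp: le_Suc_eq)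
    qed
  qed
  with adm show ?thesis
    by blast
qed

lemma shielded_inside_step:
  assumes "k < p" and q: "q < p" "1 \<le> j" "j \<le> L" "pos 0 = nd q j"
    and free: "\<And>a i. 1 \<le> a \<Longrightarrow> a \<le> k \<Longrightarrow> i \<le> j \<Longrightarrow> pos a \<noteq> nd q i"
  shows "\<exists>R. adm_removal V E R \<and>
    (\<forall>mv. (\<forall>a\<le>k. mv a = pos a \<or> {pos a, mv a} \<in> E - R) \<longrightarrow>
      shielded p L nd k mv \<or> shielded p L (\<lambda>i j. nd i (Suc L - j)) k mv)"
proof -
  \<comment> \<open>The other paths from which the left pole could be entered in this round.\<close>
  define J where "J = {i. i < p \<and> i \<noteq> q \<and> (\<exists>a. 1 \<le> a \<and> a \<le> k \<and> pos a = nd i 1)}"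
  have mv_src: "\<exists>j'\<in>{j - 1, j, Suc j}. v = nd q j'" if "v = pos 0 \<or> {pos 0, v} \<in> E - R" for v R
    using that q inner_neighbour[of q j v] by auto
  show ?thesis
  proof (cases "J = {..<p} - {q}")
    \<comment> \<open>The threatening agents are \<open>p - 1 \<ge> k\<close> distinct ones, hence
      all ignorant agents. None of them is on path \<open>q\<close>, so the source may move freely
      there.\<close>
    case True
    define R where "R = cut_edges J (\<lambda>_. 0)"
    have "J \<subset> {..<p}"
      using True q by auto
    then have adm: "adm_removal V E R"
      unfolding R_def by (rule adm_cut_edges) simp
    have J_lt: "i < p" if "i \<in> J" for i
      using that by (simp add: J_def)
    have "\<forall>i\<in>J. \<exists>a. 1 \<le> a \<and> a \<le> k \<and> pos a = nd i 1"
      by (simp add: J_def)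
    from bchoice[OF this] obtain g
      where g: "\<And>i. i \<in> J \<Longrightarrow> 1 \<le> g i \<and> g i \<le> k \<and> pos (g i) = nd i 1"
      by blast
    have "inj_on g J"
    proof (rule inj_onI)
      fix i i' assume i: "i \<in> J" "i' \<in> J" "g i = g i'"
      then show "i = i'"
        using g[OF i(1)] g[OF i(2)] nd_eq_iff[of i i' 1 1] L_ge_2 J_lt[OF i(1)] J_lt[OF i(2)] by simp
    qed
    then have "card (g ` J) = p - 1"
      using q True by (simp add: card_image)
    then have "g ` J = {1..k}"
      using g assms(1) by (intro card_seteq) auto
    then have at1: "\<exists>i<p. i \<noteq> q \<and> pos a = nd i 1 \<and> {nd i 0, nd i 1} \<in> R" if "1 \<le> a" "a \<le> k" for a
    proof -
      have "a \<in> g ` J"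
        using that \<open>g ` J = {1..k}\<close> by auto
      then obtain i where "i \<in> J" "a = g i"
        by blast
      then show ?thesis
        using g[of i] by (intro exI[of _ i]) (auto simp: J_def R_def cut_edges_def)
    qed
    have "shielded p L nd k mv \<or> shielded p L (\<lambda>i j. nd i (Suc L - j)) k mv"
      if mv: "\<And>a. a \<le> k \<Longrightarrow> mv a = pos a \<or> {pos a, mv a} \<in> E - R" for mv
    proof -
      have new: "\<exists>i j. i < p \<and> i \<noteq> q \<and> 1 \<le> j \<and> j \<le> L \<and> mv a = nd i j" if a: "1 \<le> a" "a \<le> k" for a
      proof -
        obtain i where i: "i < p" "i \<noteq> q" "pos a = nd i 1" "{nd i 0, nd i 1} \<in> R"
          using at1[OF a] by blast
        have "mv a = nd i 1 \<or> mv a = nd i 2"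
        proof (cases "mv a = pos a")
          case False
          then have e: "{nd i 1, mv a} \<in> E - R"
            using mv[OF a(2)] i by auto
          then have "mv a = nd i 0 \<or> mv a = nd i 2"
            using inner_neighbour[of i 1 "mv a"] i L_ge_2 by (auto simp: numeral_2_eq_2)
          with e i show ?thesis by (auto simp: insert_commute)
        qed (use i in auto)
        then show ?thesis
          using i L_ge_2 by (metis one_le_numeral order.refl order.trans)
      qed
      have off: "mv a \<noteq> nd q m" if "1 \<le> a" "a \<le> k" "m \<le> Suc L" for a m
        using new[OF that(1,2)] that(3) q nd_eq_iff by auto
      obtain j' where j': "j' \<in> {j - 1, j, Suc j}" "mv 0 = nd q j'"
        using mv_src[of "mv 0" R] mv[of 0] by blast
      show ?thesis
      proof (cases "j' \<le> L")
        case True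
        then show ?thesis
          using off q j' by (intro disjI1 shieldedI[of q _ j']) auto
      next
        \<comment> \<open>The source has reached the right pole, so the shield is now read from that
          side.\<close>
        case False
        then have "j' = Suc L"
          using j' q by auto
        then show ?thesis
          using off q j' by (intro disjI2 shieldedI[of q _ 0]) auto
      qed
    qed
    with adm show ?thesis
      by blast
  next
    \<comment> \<open>Some path other than \<open>q\<close> needs no cut, so \<open>q\<close> can be
      cut as well. The cut just beyond the source stops both the source and anyone coming towards it
      from the right.\<close>
    case False
    define c where "c i = (if i = q then j else 0)" for i
    define R where "R = cut_edges (insert q J) c"
    have "insert q J \<subset> {..<p}"
      using False q by (auto simp: J_def)
    then have adm: "adm_removal V E R"
      unfolding R_def by (rule adm_cut_edges) (use q in \<open>auto simp: c_def\<close>)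
    have cut_J: "{nd i 0, nd i 1} \<in> R" if "i \<in> J" for i
      using that by (auto simp: R_def cut_edges_def J_def c_def intro!: image_eqI[of _ _ i])
    have cut_q: "{nd q j, nd q (Suc j)} \<in> R"
      by (auto simp: R_def cut_edges_def c_def)
    have "shielded p L nd k mv"
      if mv: "\<And>a. a \<le> k \<Longrightarrow> mv a = pos a \<or> {pos a, mv a} \<in> E - R" for mv
    proof -
      have off: "mv a \<noteq> nd q i" if a: "1 \<le> a" "a \<le> k" "i \<le> j" for a i
      proof
        assume eq: "mv a = nd q i"
        then have e: "{nd q i, pos a} \<in> E - R"
          using mv[OF a(2)] free[OF a] by (auto simp: insert_commute)
        show False
        proof (cases "i = 0")
          case True
          then obtain i' where i': "i' < p" "pos a = nd i' 1" "{nd q i, pos a} = {nd i' 0, nd i' 1}"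
            using left_pole_neighbour[of q "pos a"] e q by auto
          then have "i' \<noteq> q"
            using free[OF a(1,2), of 1] q by auto
          then have "i' \<in> J"
            using i' a by (auto simp: J_def)
          then show False
            using cut_J e i' by auto
        next
          case False
          then have "pos a = nd q (i - 1) \<or> pos a = nd q (Suc i)"
            using inner_neighbour[of q i "pos a"] e q a by auto
          then have "pos a = nd q (Suc i)"
            using free[OF a(1,2), of "i - 1"] a by auto
          then show False
            using free[OF a(1,2), of "Suc i"] a e cut_q by (cases "i = j") auto
        qed
      qed
      have "mv 0 \<noteq> nd q (Suc j)"
      proof
        assume eq: "mv 0 = nd q (Suc j)"
        then have "pos 0 \<noteq> mv 0"
          using q nd_eq_iff[of q q j "Suc j"] by auto
        then show False
          using mv[of 0] cut_q eq q by auto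
      qed
      then obtain j' where "j' \<in> {j - 1, j}" "mv 0 = nd q j'"
        using mv_src[of "mv 0" R] mv[of 0] by blast
      then show ?thesis
        using off q by (intro shieldedI[of q _ j']) auto
    qed
    with adm show ?thesis
      by blast
  qed
qed

lemma shielded_step:
  assumes "k < p" "shielded p L nd k pos"
  shows "\<exists>R. adm_removal V E R \<and>
    (\<forall>mv. (\<forall>a\<le>k. mv a = pos a \<or> {pos a, mv a} \<in> E - R) \<longrightarrow>
      shielded p L nd k mv \<or> shielded p L (\<lambda>i j. nd i (Suc L - j)) k mv)"
proof -
  obtain q j where qj: "q < p" "j \<le> L" "pos 0 = nd q j"
    "\<And>a i. 1 \<le> a \<Longrightarrow> a \<le> k \<Longrightarrow> i \<le> j \<Longrightarrow> pos a \<noteq> nd q i"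
    using assms(2) unfolding shielded_def by blast
  show ?thesis
  proof (cases "j = 0")
    case True
    then have "pos 0 = nd 0 0" "\<And>a. 1 \<le> a \<Longrightarrow> a \<le> k \<Longrightarrow> pos a \<noteq> nd 0 0"
      using qj left_pole_eq[of q 0] p_pos by auto
    from shielded_at_pole_step[of k pos, OF assms(1) this] show ?thesis
      by blast
  next
    case False
    then show ?thesis
      using shielded_inside_step[of k q j pos, OF assms(1) qj(1) _ qj(2,3,4)] by simp
  qed
qed

section \<open>The adversary's win\<close>

lemma not_broadcast_solvable:
  assumes "1 \<le> k" "k < p"
  shows "\<not> broadcast_solvable V E k"
proof -
  let ?nd' = "\<lambda>i j. nd i (Suc L - j)"
  interpret rev: theta_paths V E p L ?nd'
    by (rule reversed)
  define Inv where "Inv pos \<longleftrightarrow> shielded p L nd k pos \<or> shielded p L ?nd' k pos" for pos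
  \<comment> \<open>The source takes the left pole and the ignorant agents its neighbours, one per
    path, for which \<open>k < p\<close> leaves room.\<close>
  define p0 where "p0 a = (if a = 0 then nd 0 0 else nd (a - 1) 1)" for a :: nat
  \<comment> \<open>Reversing twice is the identity only up to position \<open>Suc L\<close>, so the
    shield is translated back explicitly.\<close>
  have twice: "shielded p L (\<lambda>i j. ?nd' i (Suc L - j)) k mv \<Longrightarrow> shielded p L nd k mv" for mv
    unfolding shielded_def by (auto; metis diff_diff_cancel le_SucI le_trans)
  show ?thesis
  proof (rule not_broadcast_solvable_if_invariant[where Inv = Inv and ?p0.0 = p0])
    have "0 \<in> {..<p}"
      using p_pos by simp
    then have "{} \<subset> {..<p}"
      by blast
    then show "adm_removal V E {}"
      using adm_cut_edges[of "{}" "\<lambda>_. 0"] by (simp add: cut_edges_def)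
    show "inj_on p0 {..k}"
      using assms L_ge_2 by (auto simp: inj_on_def p0_def nd_eq_iff split: if_splits)
    show "p0 ` {..k} \<subseteq> V"
      using assms by (auto simp: p0_def intro!: nd_in_V)
    have "shielded p L nd k p0"
      using assms L_ge_2 by (intro shieldedI[of 0 _ 0]) (auto simp: p0_def nd_eq_iff)
    then show "Inv p0"
      by (simp add: Inv_def)
    show "pos a \<noteq> pos 0" if "Inv pos" "1 \<le> a" "a \<le> k" for pos a
      using that unfolding Inv_def shielded_def by auto
    show "\<exists>R. adm_removal V E R \<and>
        (\<forall>mv. (\<forall>a\<le>k. mv a = pos a \<or> {pos a, mv a} \<in> E - R) \<longrightarrow> Inv mv)" if "Inv pos" for pos
      using that shielded_step[OF assms(2), of pos] rev.shielded_step[OF assms(2), of pos] twice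
      unfolding Inv_def by meson
  qed (use assms in auto)
qed

end

section \<open>Enough agents: forcing a meeting\<close>

text \<open>Fix the set \<open>S\<close> of informed agents. \<open>Q pos\<close> stands for the agents winning after having
  moved to \<open>pos\<close>; the assumption \<open>meet\<close> is the induction hypothesis on the number of ignorant
  agents. Informed and ignorant agents play symmetric roles, and it suffices to move one agent
  per round.\<close>

locale theta_pursuit = theta_paths V E p L nd
  for V :: "'v set" and E p L nd +
  fixes k :: nat and S :: "nat set" and Q :: "(nat \<Rightarrow> 'v) \<Rightarrow> bool"
  assumes meet: "\<And>pos a b. \<forall>a\<le>k. pos a \<in> V \<Longrightarrow> a \<le> k \<Longrightarrow> b \<le> k \<Longrightarrow> a \<in> S \<Longrightarrow> b \<notin> S \<Longrightarrow>
      pos a = pos b \<Longrightarrow> Q pos"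
    and move: "\<And>pos. \<forall>a\<le>k. pos a \<in> V \<Longrightarrow>
      (\<And>R. adm_removal V E R \<Longrightarrow> \<exists>a\<le>k. \<exists>v. {pos a, v} \<in> E - R \<and> Q (pos(a := v))) \<Longrightarrow> Q pos"
begin

lemma reversed_pursuit: "theta_pursuit V E p L (\<lambda>i j. nd i (Suc L - j)) k S Q"
  by (intro theta_pursuit.intro theta_pursuit_axioms.intro reversed) (use meet move in blast)+

section \<open>Squeezing an agent between two of the other kind\<close>

definition valid :: "(nat \<Rightarrow> 'v) \<Rightarrow> bool" where
  "valid pos \<longleftrightarrow> (\<forall>a\<le>k. pos a \<in> V)"

lemma valid_upd: "valid pos \<Longrightarrow> q < p \<Longrightarrow> j \<le> Suc L \<Longrightarrow> valid (pos(a := nd q j))"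
  by (auto simp: valid_def nd_in_V)

definition opp :: "nat \<Rightarrow> nat \<Rightarrow> bool" where
  "opp a b \<longleftrightarrow> (a \<in> S) \<noteq> (b \<in> S)"

lemma meet_opp:
  assumes "valid pos" "a \<le> k" "b \<le> k" "opp a b" "pos a = pos b"
  shows "Q pos"
  using assms meet[of pos a b] meet[of pos b a] by (auto simp: opp_def valid_def)

text \<open>While \<open>y\<close> is strictly between, \<open>x1\<close> and \<open>x2\<close>
  approach over different edges of one path. At most one of these is cut, so \<open>j2 - j1\<close>
  can be decreased in every round.\<close>

lemma squeeze:
  assumes "valid pos" "y \<le> k" "x1 \<le> k" "x2 \<le> k" "opp x1 y" "opp x2 y" "q < p"
    and "pos y = nd q j" "pos x1 = nd q j1" "pos x2 = nd q j2" "j1 \<le> j" "j \<le> j2" "j2 \<le> Suc L"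
  shows "Q pos"
  using assms(1,8-)
proof (induction "j2 - j1" arbitrary: pos j1 j2 rule: less_induct)
  case less
  have neq: "x1 \<noteq> y" "x2 \<noteq> y"
    using assms by (auto simp: opp_def)
  show ?case
  proof (cases "j1 = j \<or> j2 = j")
    case True
    then show ?thesis
      using less meet_opp[of pos x1 y] meet_opp[of pos x2 y] assms by auto
  next
    case False
    then have lt: "j1 < j" "j < j2"
      using less by auto
    have "Q (pos(x1 := nd q (Suc j1)))"
      by (rule less.hyps[of j2 "Suc j1"])
        (use less.prems lt neq assms nd_eq_iff[of q q j1 j2] in \<open>auto intro!: valid_upd\<close>)
    moreover have "Q (pos(x2 := nd q (j2 - 1)))"
      by (rule less.hyps[of "j2 - 1" j1])
        (use less.prems lt neq assms nd_eq_iff[of q q j1 j2] in \<open>auto intro!: valid_upd\<close>)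
    moreover have "{pos x1, nd q (Suc j1)} \<in> E - R \<or> {pos x2, nd q (j2 - 1)} \<in> E - R"
      if adm: "adm_removal V E R" for R
    proof -
      have gap: "j1 < j2 - 1" "j2 - 1 \<le> L"
        using lt less.prems by auto
      have e: "{nd q j1, nd q (Suc j1)} \<in> E" "{nd q (j2 - 1), nd q (Suc (j2 - 1))} \<in> E"
        by (rule edge_in_E; use lt less.prems assms(7) in linarith)+
      moreover have "\<not> ({nd q j1, nd q (Suc j1)} \<in> R \<and> {nd q (j2 - 1), nd q (Suc (j2 - 1))} \<in> R)"
        by (metis at_most_one_cut[OF adm assms(7) gap])
      ultimately show ?thesis
        using lt less.prems by (auto simp: insert_commute)
    qed
    ultimately show ?thesis
      using less.prems(1) assms(3,4) unfolding valid_def by (intro move) blast+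
  qed
qed

section \<open>Spreading the agents over the paths\<close>

definition inside :: "nat set \<Rightarrow> (nat \<Rightarrow> 'v) \<Rightarrow> nat set" where
  "inside T pos = {a \<in> T. pos a \<noteq> nd 0 0 \<and> pos a \<noteq> nd 0 (Suc L)}"

lemma pole_iff: "q < p \<Longrightarrow> j \<le> Suc L \<Longrightarrow> nd q j = nd 0 0 \<or> nd q j = nd 0 (Suc L) \<longleftrightarrow> j = 0 \<or> j = Suc L"
  using nd_eq_iff[of q 0 j 0] nd_eq_iff[of q 0 j "Suc L"] p_pos by auto

lemma inside_iff: "a \<in> T \<Longrightarrow> pos a = nd q j \<Longrightarrow> q < p \<Longrightarrow> j \<le> Suc L \<Longrightarrow>
    a \<in> inside T pos \<longleftrightarrow> 1 \<le> j \<and> j \<le> L"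
  using pole_iff[of q j] unfolding inside_def by auto

lemma card_inside_upd:
  assumes "finite T" "a \<in> inside T pos" "q < p" "j \<le> Suc L"
  shows "card (inside T (pos(a := nd q j))) \<le> card (inside T pos)"
    and "j = 0 \<or> j = Suc L \<Longrightarrow> card (inside T (pos(a := nd q j))) < card (inside T pos)"
proof -
  have fin: "finite (inside T pos)"
    using assms(1) by (simp add: inside_def)
  have sub: "inside T (pos(a := nd q j)) \<subseteq> inside T pos"
    using assms(2) by (auto simp: inside_def)
  then show "card (inside T (pos(a := nd q j))) \<le> card (inside T pos)"
    by (rule card_mono[OF fin])
  assume "j = 0 \<or> j = Suc L"
  then have "a \<notin> inside T (pos(a := nd q j))"
    using pole_iff[OF assms(3,4)] by (auto simp: inside_def)
  then show "card (inside T (pos(a := nd q j))) < card (inside T pos)"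
    using sub assms(2) fin by (intro psubset_card_mono) auto
qed

text \<open>The agents walk apart over the edges numbered \<open>i - 1\<close> and \<open>j\<close>;
  these differ, so one is present. The potential \<open>i + (L - j)\<close> drops until somebody
  reaches a pole, where \<open>fewer\<close>, the hypothesis of an outer induction, takes
  over.\<close>

lemma exit_path:
  assumes T: "finite T" "T \<subseteq> {..k}" "a \<in> T" "b \<in> T" "a \<noteq> b" and q: "q < p"
    and fewer: "\<And>pos. valid pos \<Longrightarrow> card (inside T pos) < N \<Longrightarrow> Q pos"
    and "valid pos" "card (inside T pos) \<le> N"
    and "pos a = nd q i" "pos b = nd q j" "1 \<le> i" "i \<le> j" "j \<le> L"
  shows "Q pos"
  using assms(8-)
proof (induction "i + (L - j)" arbitrary: pos i j rule: less_induct)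
  case less
  have in_a: "a \<in> inside T pos" and in_b: "b \<in> inside T pos"
    using less.prems T q inside_iff[of a T pos q i] inside_iff[of b T pos q j] by auto
  have bounds: "i - 1 \<le> Suc L" "Suc j \<le> Suc L"
    using less.prems by auto
  have "Q (pos(a := nd q (i - 1)))"
  proof (cases "i = 1")
    case True
    then show ?thesis
      using card_inside_upd(2)[OF T(1) in_a q, of 0] less.prems q
      by (intro fewer valid_upd) auto
  next
    case False
    show ?thesis
      by (rule less.hyps[of "i - 1" j])
        (use False less.prems T q card_inside_upd(1)[OF T(1) in_a q bounds(1)] in \<open>auto intro!: valid_upd\<close>)
  qed
  moreover have "Q (pos(b := nd q (Suc j)))"
  proof (cases "j = L")
    case True
    then show ?thesis
      using card_inside_upd(2)[OF T(1) in_b q, of "Suc L"] less.prems q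
      by (intro fewer valid_upd) auto
  next
    case False
    show ?thesis
      by (rule less.hyps[of i "Suc j"])
        (use False less.prems T q card_inside_upd(1)[OF T(1) in_b q bounds(2)] in \<open>auto intro!: valid_upd\<close>)
  qed
  moreover have "{pos a, nd q (i - 1)} \<in> E - R \<or> {pos b, nd q (Suc j)} \<in> E - R"
    if adm: "adm_removal V E R" for R
  proof -
    have gap: "i - 1 < j" "j \<le> L"
      using less.prems by auto
    have e: "{nd q (i - 1), nd q (Suc (i - 1))} \<in> E" "{nd q j, nd q (Suc j)} \<in> E"
      by (rule edge_in_E; use less.prems q in linarith)+
    moreover have "\<not> ({nd q (i - 1), nd q (Suc (i - 1))} \<in> R \<and> {nd q j, nd q (Suc j)} \<in> R)"
      by (metis at_most_one_cut[OF adm q gap])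
    ultimately show ?thesis
      using less.prems by (auto simp: insert_commute)
  qed
  moreover have "a \<le> k" "b \<le> k"
    using T by auto
  ultimately show ?case
    using less.prems(1) unfolding valid_def by (intro move) blast+
qed

section \<open>Sweeping all paths\<close>

text \<open>The measure is the total distance left to go. Whichever path is intact,
  \<open>\<pi>\<close> provides an agent on it that can advance, and the first arrival decides the
  pursuit.\<close>

lemma sweep_assigned:
  assumes T: "finite T" "T \<subseteq> {..k}" "e \<in> T" "y \<in> T" "opp y e"
    and \<pi>: "bij_betw \<pi> (T - {e}) {..<p}"
    and "valid pos" "pos e = nd 0 0"
    and "\<And>a. a \<in> T - {e} \<Longrightarrow> J a \<le> Suc L \<and> pos a = nd (\<pi> a) (J a)"
  shows "Q pos"
  using assms(7-)
proof (induction "\<Sum>a\<in>T - {e}. if opp a e then J a else Suc L - J a" arbitrary: pos J rule: less_induct)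
  case less
  have \<pi>_lt: "\<pi> a < p" if "a \<in> T - {e}" for a
    using \<pi> that by (auto simp: bij_betw_def)
  have y: "y \<in> T - {e}"
    using T by (auto simp: opp_def)
  have e_at: "pos e = nd q 0" if "q < p" for q
    using left_pole_eq[OF that, of 0] less.prems p_pos by simp
  have le: "a \<le> k" if "a \<in> T" for a
    using that T by auto
  consider (caught) a where "a \<in> T - {e}" "opp a e" "J a = 0"
    | (across) a where "a \<in> T - {e}" "\<not> opp a e" "J a = Suc L"
    | (go) "\<And>a. a \<in> T - {e} \<Longrightarrow> (if opp a e then J a \<noteq> 0 else J a \<noteq> Suc L)"
    by metis
  then show ?case
  proof cases
    case caught
    then show ?thesis
      using meet_opp[of pos a e] less.prems(1) less.prems(3)[of a] e_at[of "\<pi> a"] \<pi>_lt[of a] le T by auto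
  next
    \<comment> \<open>\<open>e\<close> and \<open>a\<close> are of the same kind and hold both ends
      of the path of \<open>y\<close>, which is of the other kind.\<close>
    case across
    have "pos a = nd (\<pi> y) (Suc L)"
      using across less.prems(3)[of a] right_pole_eq[OF \<pi>_lt[OF y] \<pi>_lt[of a]] by auto
    moreover have "opp e y" "opp a y"
      using T(5) across by (auto simp: opp_def)
    ultimately show ?thesis
      using squeeze[of pos y e a "\<pi> y" "J y" 0 "Suc L"] less.prems(1) less.prems(3)[OF y]
        e_at[OF \<pi>_lt[OF y]] \<pi>_lt[OF y] le T y across by auto
  next
    case go
    have upd: "Q (pos(a := nd (\<pi> a) j))"
      if a: "a \<in> T - {e}" and j: "j \<le> Suc L"
        "(if opp a e then j else Suc L - j) < (if opp a e then J a else Suc L - J a)" for a j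
    proof (rule less.hyps[of "J(a := j)"])
      show "(\<Sum>b\<in>T - {e}. if opp b e then (J(a := j)) b else Suc L - (J(a := j)) b)
          < (\<Sum>b\<in>T - {e}. if opp b e then J b else Suc L - J b)"
        using a j T(1) by (intro sum_strict_mono_ex1) (auto intro!: bexI[of _ a])
      show "valid (pos(a := nd (\<pi> a) j))"
        using less.prems \<pi>_lt[OF a] j by (intro valid_upd) auto
    qed (use less.prems a j in auto)
    show ?thesis
    proof (rule move)
      show "\<forall>a\<le>k. pos a \<in> V"
        using less.prems by (simp add: valid_def)
      fix R assume "adm_removal V E R"
      then obtain i where i: "i < p" "\<forall>j\<le>L. {nd i j, nd i (Suc j)} \<notin> R"
        using ex_intact_path by blast
      then obtain a where a: "a \<in> T - {e}" "\<pi> a = i"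
        using \<pi> unfolding bij_betw_def by (metis imageE lessThan_iff)
      note at = less.prems(3)[OF a(1)]
      show "\<exists>a\<le>k. \<exists>v. {pos a, v} \<in> E - R \<and> Q (pos(a := v))"
      proof (cases "opp a e")
        case True
        then have "J a \<noteq> 0"
          using go[OF a(1)] by simp
        then have "{pos a, nd i (J a - 1)} \<in> E - R"
          using at a i edge_in_E[of i "J a - 1"] spec[OF i(2), of "J a - 1"]
          by (auto simp: insert_commute)
        moreover have "Q (pos(a := nd i (J a - 1)))"
          using upd[OF a(1), of "J a - 1"] True \<open>J a \<noteq> 0\<close> at a by auto
        ultimately show ?thesis
          using a le by blast
      next
        case False
        then have "J a \<le> L"
          using go[OF a(1)] at by auto
        then have "{pos a, nd i (Suc (J a))} \<in> E - R"
          using at a i edge_in_E[of i "J a"] by auto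
        moreover have "Q (pos(a := nd i (Suc (J a))))"
          using upd[OF a(1), of "Suc (J a)"] False \<open>J a \<le> L\<close> at a by auto
        ultimately show ?thesis
          using a le by blast
      qed
    qed
  qed
qed

definition thin :: "nat set \<Rightarrow> (nat \<Rightarrow> 'v) \<Rightarrow> bool" where
  "thin T pos \<longleftrightarrow> (\<forall>a\<in>T. \<forall>b\<in>T. \<forall>q i j. q < p \<and> 1 \<le> i \<and> i \<le> L \<and> 1 \<le> j \<and> j \<le> L \<and>
     pos a = nd q i \<and> pos b = nd q j \<longrightarrow> a = b)"

lemma inside_paths:
  assumes T: "T \<subseteq> {..k}" and "valid pos" "thin T pos"
  obtains g where "inj_on g (inside T pos)" "g ` inside T pos \<subseteq> {..<p}"
    "\<And>a. a \<in> inside T pos \<Longrightarrow> \<exists>j. 1 \<le> j \<and> j \<le> L \<and> pos a = nd (g a) j"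
proof -
  have "\<exists>q j. q < p \<and> 1 \<le> j \<and> j \<le> L \<and> pos a = nd q j" if a: "a \<in> inside T pos" for a
  proof -
    have "a \<in> T"
      using a by (simp add: inside_def)
    then have "pos a \<in> V"
      using T assms(2) by (auto simp: valid_def)
    then obtain q j where "q < p" "j \<le> Suc L" "pos a = nd q j"
      by (elim V_cases)
    then show ?thesis
      using inside_iff[of a T pos q j] a \<open>a \<in> T\<close> by auto
  qed
  then obtain g h where gh: "\<And>a. a \<in> inside T pos \<Longrightarrow>
      g a < p \<and> 1 \<le> h a \<and> h a \<le> L \<and> pos a = nd (g a) (h a)"
    by metis
  have "inj_on g (inside T pos)"
  proof (rule inj_onI)
    fix a b assume ab: "a \<in> inside T pos" "b \<in> inside T pos" "g a = g b"
    then have "a \<in> T" "b \<in> T"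
      by (auto simp: inside_def)
    then show "a = b"
      using assms(3) gh[OF ab(1)] gh[OF ab(2)] ab(3) unfolding thin_def by metis
  qed
  then show ?thesis
    using gh by (intro that) auto
qed

text \<open>A pole lies on every path, so agents on poles can be assigned to any paths that the
  inside agents leave over. Without \<open>e\<close> there are \<open>p\<close> agents for
  \<open>p\<close> paths.\<close>

lemma sweep:
  assumes T: "finite T" "T \<subseteq> {..k}" "card T = Suc p" "e \<in> T" "y \<in> T" "opp y e"
    and "valid pos" "thin T pos" "pos e = nd 0 0"
  shows "Q pos"
proof -
  let ?U = "inside T pos" and ?W = "T - {e} - inside T pos"
  obtain g where g: "inj_on g ?U" "g ` ?U \<subseteq> {..<p}"
    "\<And>a. a \<in> ?U \<Longrightarrow> \<exists>j. 1 \<le> j \<and> j \<le> L \<and> pos a = nd (g a) j"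
    using inside_paths[OF T(2) assms(7,8)] by blast
  have U: "?U \<subseteq> T - {e}" "finite ?U"
    using T assms(9) by (auto simp: inside_def)
  have "card ?W = p - card ?U"
    using T U by (simp add: card_Diff_subset)
  also have "\<dots> = card ({..<p} - g ` ?U)"
    using g U by (simp add: card_Diff_subset card_image)
  finally obtain h where h: "bij_betw h ?W ({..<p} - g ` ?U)"
    using T(1) finite_same_card_bij[of ?W "{..<p} - g ` ?U"] by auto
  define \<pi> where "\<pi> a = (if a \<in> ?U then g a else h a)" for a
  have "bij_betw \<pi> ?U (g ` ?U)"
    using g(1) by (auto simp: bij_betw_def \<pi>_def inj_on_def)
  moreover have "bij_betw \<pi> ?W ({..<p} - g ` ?U)"
    using h by (subst bij_betw_cong[of ?W \<pi> h]) (auto simp: \<pi>_def)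
  ultimately have "bij_betw \<pi> (?U \<union> ?W) (g ` ?U \<union> ({..<p} - g ` ?U))"
    by (rule bij_betw_combine) auto
  moreover have "?U \<union> ?W = T - {e}" "g ` ?U \<union> ({..<p} - g ` ?U) = {..<p}"
    using U g(2) by auto
  ultimately have \<pi>: "bij_betw \<pi> (T - {e}) {..<p}"
    by simp
  have "\<exists>j\<le>Suc L. pos a = nd (\<pi> a) j" if a: "a \<in> T - {e}" for a
  proof (cases "a \<in> ?U")
    case True
    then show ?thesis
      using g(3)[OF True] by (auto simp: \<pi>_def intro: le_SucI)
  next
    case False
    then have "pos a = nd 0 0 \<or> pos a = nd 0 (Suc L)"
      using a by (auto simp: inside_def)
    moreover have "\<pi> a < p" "0 < p"
      using \<pi> a p_pos by (auto simp: bij_betw_def)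
    ultimately show ?thesis
      using left_pole_eq[of "\<pi> a" 0] right_pole_eq[of "\<pi> a" 0] by auto
  qed
  then obtain J where "\<And>a. a \<in> T - {e} \<Longrightarrow> J a \<le> Suc L \<and> pos a = nd (\<pi> a) (J a)"
    by metis
  then show ?thesis
    using sweep_assigned[OF T(1,2,4,5,6) \<pi> assms(7,9)] by blast
qed

lemma thin_reversed:
  assumes "thin T pos"
  shows "theta_pursuit.thin p L (\<lambda>i j. nd i (Suc L - j)) T pos"
proof -
  interpret rev: theta_pursuit V E p L "\<lambda>i j. nd i (Suc L - j)" k S Q
    by (rule reversed_pursuit)
  show ?thesis
    unfolding rev.thin_def
  proof (intro ballI allI impI, elim conjE)
    fix a b q i j
    assume "a \<in> T" "b \<in> T" "q < p" "1 \<le> i" "i \<le> L" "1 \<le> j" "j \<le> L"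
      "pos a = nd q (Suc L - i)" "pos b = nd q (Suc L - j)"
    moreover from this have "1 \<le> Suc L - i" "Suc L - i \<le> L" "1 \<le> Suc L - j" "Suc L - j \<le> L"
      by auto
    ultimately show "a = b"
      using assms unfolding thin_def by blast
  qed
qed

section \<open>Forcing a meeting\<close>

text \<open>By the pigeonhole principle, \<open>p + 1\<close> agents with at most one inside each
  path leave somebody on a pole. The right pole is handled in reversed coordinates.\<close>

lemma force_meeting_thin:
  assumes T: "finite T" "T \<subseteq> {..k}" "card T = Suc p" "s \<in> T" "u \<in> T" "s \<in> S" "u \<notin> S"
    and "valid pos" "thin T pos"
  shows "Q pos"
proof -
  obtain g where g: "inj_on g (inside T pos)" "g ` inside T pos \<subseteq> {..<p}"
    by (rule inside_paths[OF T(2) assms(8,9)])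
  have "inside T pos \<noteq> T"
    using card_inj_on_le[OF g] T(3) by auto
  then obtain e where e: "e \<in> T" "pos e = nd 0 0 \<or> pos e = nd 0 (Suc L)"
    by (auto simp: inside_def)
  obtain y where y: "y \<in> T" "(y \<in> S) \<noteq> (e \<in> S)"
    using T by blast
  interpret rev: theta_pursuit V E p L "\<lambda>i j. nd i (Suc L - j)" k S Q
    by (rule reversed_pursuit)
  show ?thesis
    using e(2) sweep[OF T(1-3) e(1) y(1) _ assms(8,9)]
      rev.sweep[OF T(1-3) e(1) y(1) _ _ thin_reversed[OF assms(9)]] y(2) assms(8)
    by (auto simp: opp_def rev.opp_def valid_def rev.valid_def)
qed

text \<open>Induction on the number of agents inside: two of them in one path can be driven apart
  until this number drops.\<close>

lemma force_meeting:
  assumes T: "finite T" "T \<subseteq> {..k}" "card T = Suc p" "s \<in> T" "u \<in> T" "s \<in> S" "u \<notin> S"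
    and "valid pos"
  shows "Q pos"
  using assms(8)
proof (induction "card (inside T pos)" arbitrary: pos rule: less_induct)
  case less
  show ?case
  proof (cases "thin T pos")
    case True
    then show ?thesis
      using force_meeting_thin[OF T less.prems] by blast
  next
    case False
    then obtain a b q i j where ab: "a \<in> T" "b \<in> T" "a \<noteq> b" "q < p" "1 \<le> i" "i \<le> L" "1 \<le> j" "j \<le> L"
      "pos a = nd q i" "pos b = nd q j"
      unfolding thin_def by blast
    show ?thesis
    proof (cases "i \<le> j")
      case True
      then show ?thesis
        using exit_path[OF T(1,2) ab(1,2,3,4) less.hyps less.prems order.refl ab(9,10)] ab by blast
    next
      case False
      then show ?thesis
        using exit_path[OF T(1,2) ab(2,1) ab(3)[symmetric] ab(4) less.hyps less.prems order.refl ab(10,9)] ab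
        by auto
    qed
  qed
qed

end

section \<open>Informing all agents, one meeting at a time\<close>

context theta_paths
begin

text \<open>Induction on the number of ignorant agents. The last hypothesis says that all meetings
  at the current positions have already been counted.\<close>

lemma wins_if_enough_agents:
  assumes "p \<le> k" and "\<forall>a\<le>k. pos a \<in> V" "S \<subseteq> {..k}" "S \<noteq> {}"
    and "\<And>a b. a \<le> k \<Longrightarrow> b \<in> S \<Longrightarrow> pos a = pos b \<Longrightarrow> a \<in> S"
  shows "wins V E k (pos, S)"
  using assms(2-)
proof (induction "card ({..k} - S)" arbitrary: pos S rule: less_induct)
  case less
  \<comment> \<open>The informed set is updated exactly as \<open>step\<close> does it, so
    \<open>Q\<close> describes the configuration after a move to \<open>pos\<close>.\<close>
  define Q where "Q pos \<longleftrightarrow> wins V E k (pos, S \<union> {a. a \<le> k \<and> (\<exists>b\<in>S. pos b = pos a)})" for pos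
  have step: "step k (pos, S) mv = (mv, S \<union> {a. a \<le> k \<and> (\<exists>b\<in>S. mv b = mv a)})" for pos mv :: "nat \<Rightarrow> 'v"
    by (simp add: step_def)
  have meet: "Q pos" if v: "\<forall>a\<le>k. pos a \<in> V" and ab: "a \<le> k" "b \<le> k" "a \<in> S" "b \<notin> S" "pos a = pos b"
    for pos a b
    unfolding Q_def
  proof (rule less.hyps)
    let ?S' = "S \<union> {a. a \<le> k \<and> (\<exists>b\<in>S. pos b = pos a)}"
    have "b \<in> ?S'"
      using ab by auto
    then have "{..k} - ?S' \<subset> {..k} - S"
      using ab by blast
    then show "card ({..k} - ?S') < card ({..k} - S)"
      by (intro psubset_card_mono) auto
    show "?S' \<subseteq> {..k}" "?S' \<noteq> {}"
      using less.prems by auto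
    show "c \<in> ?S'" if "c \<le> k" "d \<in> ?S'" "pos c = pos d" for c d
      using that by force
  qed (use v in auto)
  have same: "S \<union> {a. a \<le> k \<and> (\<exists>b\<in>S. pos b = pos a)} = S"
    if "\<And>a b. a \<in> S \<Longrightarrow> b \<le> k \<Longrightarrow> b \<notin> S \<Longrightarrow> pos a \<noteq> pos b" for pos :: "nat \<Rightarrow> 'v"
    using that by blast
  interpret theta_pursuit V E p L nd k S Q
  proof
    show "Q pos" if "\<forall>a\<le>k. pos a \<in> V" "a \<le> k" "b \<le> k" "a \<in> S" "b \<notin> S" "pos a = pos b" for pos a b
      using meet that by blast
  next
    fix pos :: "nat \<Rightarrow> 'v"
    assume v: "\<forall>a\<le>k. pos a \<in> V"
      and mv: "\<And>R. adm_removal V E R \<Longrightarrow> \<exists>a\<le>k. \<exists>v. {pos a, v} \<in> E - R \<and> Q (pos(a := v))"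
    show "Q pos"
    proof (cases "\<exists>a b. a \<in> S \<and> b \<le> k \<and> b \<notin> S \<and> pos a = pos b")
      case True
      then show ?thesis
        using meet[OF v] less.prems(2) by blast
    next
      \<comment> \<open>No two kinds meet at \<open>pos\<close>, so the update leaves
        \<open>S\<close> unchanged, and the move of one agent is played as a round in which all
        others stay.\<close>
      case False
      have "wins V E k (pos, S)"
      proof (rule winsI[OF finite_E])
        fix R assume "adm_removal V E R"
        then obtain a v where "a \<le> k" "{pos a, v} \<in> E - R" "Q (pos(a := v))"
          using mv by blast
        then show "\<exists>mv. legal_moves E k R (pos, S) (step k (pos, S) mv) \<and> wins V E k (step k (pos, S) mv)"
          by (intro exI[of _ "pos(a := v)"]) (auto simp: legal_moves_def step Q_def)
      qed
      then show ?thesis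
        using False same[of pos] unfolding Q_def by metis
    qed
  qed
  show ?case
  proof (cases "{..k} \<subseteq> S")
    case True
    then have "wins_within V E k 0 (pos, S)"
      by simp
    then show ?thesis
      unfolding wins_def by blast
  next
    case False
    then obtain s u where su: "s \<in> S" "s \<le> k" "u \<le> k" "u \<notin> S"
      using less.prems by blast
    \<comment> \<open>There are \<open>k + 1 \<ge> p + 1\<close> agents; a team of exactly
      \<open>p + 1\<close> with both kinds in it does the pursuit.\<close>
    have "\<exists>T. {s, u} \<subseteq> T \<and> T \<subseteq> {..k} \<and> card T = Suc p"
      using su assms(1) p_pos by (intro exists_subset_between) (auto simp: card_insert_if)
    then obtain T where T: "s \<in> T" "u \<in> T" "T \<subseteq> {..k}" "card T = Suc p"
      by blast
    moreover have "valid pos"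
      using less.prems(1) by (simp add: valid_def)
    ultimately have "Q pos"
      using force_meeting[of T s u pos] su finite_subset[OF T(3)] by simp
    then show ?thesis
      using same[of pos] less.prems(4) unfolding Q_def by metis
  qed
qed

lemma broadcast_solvable_iff:
  assumes "1 \<le> k"
  shows "broadcast_solvable V E k \<longleftrightarrow> p \<le> k"
proof
  show "broadcast_solvable V E k \<Longrightarrow> p \<le> k"
    using not_broadcast_solvable[OF assms] by (meson not_less)
next
  assume "p \<le> k"
  then show "broadcast_solvable V E k"
    by (intro broadcast_solvableI wins_if_enough_agents) (auto dest: inj_onD)
qed

end

section \<open>The uniform theta graph\<close>

text \<open>The path index is dropped at both ends, so that all paths share their poles and all
  edges take one form.\<close>

definition theta_node :: "nat \<Rightarrow> nat \<Rightarrow> nat \<Rightarrow> tvert" where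
  "theta_node L i j = (if j = 0 then Pole False else if j = Suc L then Pole True else Inner i j)"

lemma theta_V_replicate:
  "theta_V (replicate p L) = {Pole False, Pole True} \<union> (\<lambda>(i, j). Inner i j) ` ({..<p} \<times> {1..L})"
  by (auto simp: theta_V_def)

lemma card_theta_V_replicate: "card (theta_V (replicate p L)) = p * L + 2"
proof -
  have "card ((\<lambda>(i, j). Inner i j) ` ({..<p} \<times> {1..L})) = p * L"
    by (subst card_image) (auto simp: inj_on_def card_cartesian_product)
  then show ?thesis
    unfolding theta_V_replicate by (subst card_Un_disjoint) auto
qed

lemma theta_paths_replicate:
  assumes "1 \<le> p" "2 \<le> L"
  shows "theta_paths (theta_V (replicate p L)) (theta_E (replicate p L)) p L (theta_node L)"
proof
  show "theta_V (replicate p L) = {theta_node L i j | i j. i < p \<and> j \<le> Suc L}" (is "?V = ?V'")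
  proof
    have "Pole False = theta_node L 0 0" "Pole True = theta_node L 0 (Suc L)"
      "\<And>i j. 1 \<le> j \<Longrightarrow> j \<le> L \<Longrightarrow> Inner i j = theta_node L i j"
      by (auto simp: theta_node_def)
    then show "?V \<subseteq> ?V'"
      using assms unfolding theta_V_replicate
      by (auto; metis One_nat_def Suc_le_lessD le_SucI le_refl zero_le)
    show "?V' \<subseteq> ?V"
      by (auto simp: theta_V_def theta_node_def)
  qed
  show "theta_E (replicate p L) = {{theta_node L i j, theta_node L i (Suc j)} | i j. i < p \<and> j \<le> L}"
    (is "?E = ?E'")
  proof
    have "{Inner i j, Inner i (Suc j)} = {theta_node L i j, theta_node L i (Suc j)}" if "1 \<le> j" "j < L" for i j
      using that by (auto simp: theta_node_def)
    moreover have "{Pole False, Inner i 1} = {theta_node L i 0, theta_node L i (Suc 0)}"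
      "{Inner i L, Pole True} = {theta_node L i L, theta_node L i (Suc L)}" for i
      using assms by (auto simp: theta_node_def)
    ultimately show "?E \<subseteq> ?E'"
      using assms unfolding theta_E_def by (auto; metis le_refl less_imp_le zero_le)
    show "?E' \<subseteq> ?E"
    proof clarify
      fix i j assume ij: "i < p" "j \<le> L"
      consider "j = 0" | "j = L" | "1 \<le> j" "j < L"
        using ij by linarith
      then show "{theta_node L i j, theta_node L i (Suc j)} \<in> theta_E (replicate p L)"
        using assms ij by cases (auto simp: theta_E_def theta_node_def)
    qed
  qed
qed (use assms in \<open>auto simp: theta_node_def\<close>)

text \<open>Subtraction is on naturals: \<open>2 < n\<close> makes \<open>n - 2\<close> exact and
  positive, so that there is at least one path.\<close>

theorem theorem3:
  fixes f :: "nat \<Rightarrow> nat" and n :: nat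
  assumes "filterlim f at_top at_top"
    and "2 < n" and "3 \<le> f n" and "f n dvd (n - 2)"
  shows "let p = (n - 2) div f n;
             V = theta_V (replicate p (f n));
             E = theta_E (replicate p (f n))
         in card V = n
            \<and> real (card E) = real n * (1 + 1 / real (f n)) - 2 * (1 + 1 / real (f n))
            \<and> real (card E) / real (card V)
                = 1 + 1 / real (f n) - 2 / real n * (1 + 1 / real (f n))
            \<and> (\<forall>k\<ge>1. broadcast_solvable V E k \<longleftrightarrow> p \<le> k)"
proof -
  define L where "L = f n"
  define p where "p = (n - 2) div L"
  have L: "3 \<le> L"
    using assms by (simp add: L_def)
  have pL: "p * L = n - 2"
    using assms by (simp add: p_def L_def)
  then have n: "n = p * L + 2"
    using assms(2) by simp
  have "1 \<le> p"
    using pL assms(2) by (cases p) auto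
  then interpret theta_paths "theta_V (replicate p L)" "theta_E (replicate p L)" p L "theta_node L"
    using L by (intro theta_paths_replicate) auto
  have V: "card (theta_V (replicate p L)) = n"
    using n by (simp add: card_theta_V_replicate)
  \<comment> \<open>The count \<open>p * (L + 1)\<close> equals \<open>(n - 2) * (1 + 1 / L)\<close>
    because \<open>p * L = n - 2\<close>.\<close>
  have E: "real (card (theta_E (replicate p L))) = real n * (1 + 1 / real L) - 2 * (1 + 1 / real L)"
    using L unfolding card_E n by (simp add: field_simps)
  have "real (card (theta_E (replicate p L))) / real n
      = 1 + 1 / real L - 2 / real n * (1 + 1 / real L)"
    unfolding E using assms(2) by (simp add: field_simps)
  with V E broadcast_solvable_iff show ?thesis
    by (simp add: Let_def p_def L_def)
qed

end
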